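(* Let $\mathcal{H}^n$ be an $n$-dimensional real or complex Hilbert space, let $\mathcal{W}=\{(W_i,v_i)\}_{i=1}^N$ be a fusion frame for $\mathcal{H}^n$, and for each $i=1,\dots,N$ let $\phi_i=\{f_{ij}\}_{j=1}^{m_i}$ be a finite frame for $W_i$. Assume that each frame $\phi_i$ has orthogonal elements, i.e. $\langle f_{ij},f_{ik}\rangle=0$ for $j\neq k$. Then $$\mathcal{R}_{\mathcal{W}}(x)=\sum_{i=1}^N\mathcal{R}_{\phi_i}(x)\qquad\text{for all } x\in\mathcal{H}^n \text{ with } \|x\|=1,$$ where $\mathcal{R}_{\mathcal{W}}$ and $\mathcal{R}_{\phi_i}$ are the redundancy functions of the fusion frame $\mathcal{W}$ and of the frames $\phi_i$.
   Context: A fusion frame for $\mathcal{H}^n$ is a family $\{(W_i,v_i)\}_{i=1}^N$ of subspaces $W_i\subseteq\mathcal{H}^n$ with weights $v_i>0$ for which there are constants $0<A\le B<\infty$ with $A\|x\|^2\le\sum_{i=1}^N v_i^2\|P_{W_i}(x)\|^2\le B\|x\|^2$ for all $x\in\mathcal{H}^n$, where $P_W$ denotes the orthogonal projection of $\mathcal{H}^n$ onto a subspace $W$. For unit vectors $x\in\mathcal{H}^n$, the redundancy function of the fusion frame is $\mathcal{R}_{\mathcal{W}}(x)=\sum_{i=1}^N\|P_{W_i}(x)\|^2$, and the redundancy function of $\phi_i=\{f_{ij}\}_{j=1}^{m_i}$ is given by the formula $\mathcal{R}_{\phi_i}(x)=\sum_{j=1}^{m_i}\|P_{\langle f_{ij}\rangle}(x)\|^2$,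 evaluated at unit vectors of the whole space $\mathcal{H}^n$, where $\langle f_{ij}\rangle=\operatorname{span}\{f_{ij}\}$. *)

theory Defs
  imports "HOL-Analysis.Analysis" "Jordan_Normal_Form.Conjugate"
begin

text \<open>
  The scalars range over the sort of types that are both a \<^class>\<open>real_normed_field\<close> and a
  \<^class>\<open>conjugatable_field\<close>. The intended instances are \<^typ>\<open>real\<close> (with the identity as
  conjugation) and \<^typ>\<open>complex\<close> (with \<^const>\<open>cnj\<close>), so that real and complex inner product
  spaces are treated uniformly; up to isomorphism there are no other normed fields in this sense
  (Gelfand-Mazur). The inner product is linear in its first argument.
\<close>

locale inner_product_space = vector_space scale
  for scale :: "'k::{real_normed_field, conjugatable_field} \<Rightarrow> 'v::ab_group_add \<Rightarrow> 'v" +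
  fixes ip :: "'v \<Rightarrow> 'v \<Rightarrow> 'k"
  assumes ip_add_left: "ip (x + y) z = ip x z + ip y z"
    and ip_scale_left: "ip (scale c x) y = c * ip x y"
    and ip_commute: "ip y x = conjugate (ip x y)"
    and ip_self_nonneg: "ip x x \<in> \<real>\<^sub>\<ge>\<^sub>0"
    and ip_self_eq_0: "ip x x = 0 \<Longrightarrow> x = 0"
begin

text \<open>Since \<open>ip x x\<close> is a nonnegative real scalar, its absolute value is \<open>ip x x\<close> itself,
  viewed as an element of \<^typ>\<open>real\<close>.\<close>

definition ip_norm :: "'v \<Rightarrow> real" where
  "ip_norm x = sqrt (norm (ip x x))"

definition orth_proj :: "'v set \<Rightarrow> 'v \<Rightarrow> 'v" where
  "orth_proj W x = (THE y. y \<in> W \<and> (\<forall>w\<in>W. ip (x - y) w = 0))"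

definition fusion_frame :: "nat \<Rightarrow> (nat \<Rightarrow> 'v set) \<Rightarrow> (nat \<Rightarrow> real) \<Rightarrow> bool" where
  "fusion_frame N W v \<longleftrightarrow>
     (\<forall>i\<in>{1..N}. subspace (W i) \<and> v i > 0) \<and>
     (\<exists>A B. 0 < A \<and> A \<le> B \<and>
        (\<forall>x. A * (ip_norm x)\<^sup>2 \<le> (\<Sum>i=1..N. (v i)\<^sup>2 * (ip_norm (orth_proj (W i) x))\<^sup>2) \<and>
             (\<Sum>i=1..N. (v i)\<^sup>2 * (ip_norm (orth_proj (W i) x))\<^sup>2) \<le> B * (ip_norm x)\<^sup>2))"

definition frame_for :: "'v set \<Rightarrow> nat \<Rightarrow> (nat \<Rightarrow> 'v) \<Rightarrow> bool" where
  "frame_for W m f \<longleftrightarrow>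
     (\<forall>j\<in>{1..m}. f j \<in> W) \<and>
     (\<exists>A B. 0 < A \<and> A \<le> B \<and>
        (\<forall>x\<in>W. A * (ip_norm x)\<^sup>2 \<le> (\<Sum>j=1..m. (norm (ip x (f j)))\<^sup>2) \<and>
               (\<Sum>j=1..m. (norm (ip x (f j)))\<^sup>2) \<le> B * (ip_norm x)\<^sup>2))"

text \<open>The redundancy function of a fusion frame does not involve its weights. Both redundancy
  functions are meant to be evaluated at unit vectors of the whole space.\<close>

definition fusion_redundancy :: "nat \<Rightarrow> (nat \<Rightarrow> 'v set) \<Rightarrow> 'v \<Rightarrow> real" where
  "fusion_redundancy N W x = (\<Sum>i=1..N. (ip_norm (orth_proj (W i) x))\<^sup>2)"

definition frame_redundancy :: "nat \<Rightarrow> (nat \<Rightarrow> 'v) \<Rightarrow> 'v \<Rightarrow> real" where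
  "frame_redundancy m f x = (\<Sum>j=1..m. (ip_norm (orth_proj (span {f j}) x))\<^sup>2)"

lemma orth_proj_eqI:
  assumes "subspace W" "y \<in> W" "\<And>w. w \<in> W \<Longrightarrow> ip (x - y) w = 0"
  shows "orth_proj W x = y"
  unfolding orth_proj_def
proof (rule the_equality)
  fix z assume z: "z \<in> W \<and> (\<forall>w\<in>W. ip (x - z) w = 0)"
  have W: "z - y \<in> W" using assms z by (simp add: subspace_diff)
  have "ip (x - y) (z - y) = ip (x - z) (z - y) + ip (z - y) (z - y)"
    using ip_add_left[of "x - z" "z - y" "z - y"] by simp
  then have "ip (z - y) (z - y) = 0" using assms(3)[OF W] z W by simp
  then show "z = y" using ip_self_eq_0 by fastforce
qed (use assms in auto)

end

text \<open>An \<open>n\<close>-dimensional Hilbert space; completeness is automatic in finite dimension.\<close>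

locale hilbert_space_dim = inner_product_space +
  fixes n :: nat
  assumes ex_basis: "\<exists>B. finite B \<and> card B = n \<and> independent B \<and> span B = UNIV"

lemma hilbert_space_dim_euclidean:
  "hilbert_space_dim (scaleR :: real \<Rightarrow> 'a::euclidean_space \<Rightarrow> 'a) inner DIM('a)"
proof unfold_locales
  show "\<exists>B::'a set. finite B \<and> card B = DIM('a) \<and>
      \<not> module.dependent scaleR B \<and> module.span scaleR B = UNIV"
    using independent_Basis span_Basis finite_Basis
    unfolding dependent_raw_def span_raw_def by blast
qed (auto simp: algebra_simps inner_commute nonneg_Reals_def)

lemma hilbert_space_dim_complex_vec:
  "hilbert_space_dim (\<lambda>c (x :: complex ^ 'n). c *s x) (\<lambda>x y. \<Sum>i\<in>UNIV. x $ i * cnj (y $ i)) CARD('n)"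
proof unfold_locales
  show "(\<Sum>i\<in>UNIV. x $ i * cnj (x $ i)) \<in> \<real>\<^sub>\<ge>\<^sub>0" for x :: "complex ^ 'n"
    by (auto simp: complex_mult_cnj complex_nonneg_Reals_iff intro!: sum_nonneg)
  show "x = 0" if "(\<Sum>i\<in>UNIV. x $ i * cnj (x $ i)) = 0" for x :: "complex ^ 'n"
  proof -
    have "(\<Sum>i\<in>UNIV. (cmod (x $ i))\<^sup>2) = 0"
      using that unfolding complex_norm_square[symmetric] of_real_sum[symmetric] of_real_eq_0_iff .
    then show ?thesis by (simp add: sum_nonneg_eq_0_iff vec_eq_iff)
  qed
  have "finite (cart_basis :: (complex ^ 'n) set)" "card (cart_basis :: (complex ^ 'n) set) = CARD('n)"
    using finite_cart_basis card_cart_basis by auto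
  then show "\<exists>B::(complex ^ 'n) set. finite B \<and> card B = CARD('n) \<and>
      \<not> module.dependent (*s) B \<and> module.span (*s) B = UNIV"
    using independent_cart_basis span_cart_basis by blast
qed (auto simp: algebra_simps sum.distrib sum_distrib_left)

end

theory Submission
  imports Defs
begin

text \<open>
  By the lower frame bound, a vector of \<open>W\<^sub>i\<close> orthogonal to \<open>\<phi>\<^sub>i\<close> is zero, so every vector of
  \<open>W\<^sub>i\<close> equals its Fourier expansion in \<open>\<phi>\<^sub>i\<close>. Hence the projection
  onto \<open>W\<^sub>i\<close> is the sum of the projections onto the lines \<open>\<langle>f\<^sub>i\<^sub>j\<rangle>\<close>, which are pairwise
  orthogonal, and Pythagoras' theorem gives the identity for each \<open>i\<close> separately.
\<close>

context inner_product_space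
begin

lemma ip_zero_left [simp]: "ip 0 y = 0"
  using ip_add_left[of 0 0 y] by simp

lemma ip_diff_left: "ip (x - y) z = ip x z - ip y z"
  using ip_add_left[of "x - y" y z] by (simp add: algebra_simps)

lemma ip_sum_left: "ip (\<Sum>j\<in>J. g j) z = (\<Sum>j\<in>J. ip (g j) z)"
  by (induction J rule: infinite_finite_induct) (simp_all add: ip_add_left)

lemma ip_eq_0_commute: "ip x y = 0 \<Longrightarrow> ip y x = 0"
  using ip_commute[of x y] by simp

lemma ip_zero_right [simp]: "ip x 0 = 0"
  by (simp add: ip_eq_0_commute)

lemma ip_add_right: "ip z (x + y) = ip z x + ip z y"
  by (metis ip_commute ip_add_left conjugate_dist_add)

lemma ip_scale_right: "ip x (scale c y) = conjugate c * ip x y"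
  by (metis ip_commute ip_scale_left conjugate_dist_mul)

lemma ip_sum_right: "ip z (\<Sum>j\<in>J. g j) = (\<Sum>j\<in>J. ip z (g j))"
  by (induction J rule: infinite_finite_induct) (simp_all add: ip_add_right)

lemma ip_norm_sq: "(ip_norm x)\<^sup>2 = norm (ip x x)"
  by (simp add: ip_norm_def)

text \<open>Links the real-valued norm to the scalar-valued \<open>ip\<close>: norm identities can
  be computed in \<open>'k\<close> and pulled back by injectivity of \<open>of_real\<close>.\<close>

lemma of_real_ip_norm_sq: "of_real ((ip_norm x)\<^sup>2) = ip x x"
  using ip_self_nonneg[of x] by (auto simp: ip_norm_sq nonneg_Reals_def)

text \<open>Pythagoras: in the bilinear expansion of the left-hand side only the diagonal terms
  survive.\<close>

lemma ip_norm_sum_orthogonal: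
  assumes "finite J" "\<And>j k. j \<in> J \<Longrightarrow> k \<in> J \<Longrightarrow> j \<noteq> k \<Longrightarrow> ip (g j) (g k) = 0"
  shows "(ip_norm (\<Sum>j\<in>J. g j))\<^sup>2 = (\<Sum>j\<in>J. (ip_norm (g j))\<^sup>2)"
proof -
  have "ip (\<Sum>j\<in>J. g j) (\<Sum>j\<in>J. g j) = (\<Sum>j\<in>J. \<Sum>k\<in>J. ip (g j) (g k))"
    by (simp only: ip_sum_left ip_sum_right) (rule sum.swap)
  also have "\<dots> = (\<Sum>j\<in>J. \<Sum>k\<in>J. if k = j then ip (g j) (g j) else 0)"
    by (intro sum.cong refl) (use assms(2) in auto)
  also have "\<dots> = (\<Sum>j\<in>J. ip (g j) (g j))"
    using assms(1) by simp
  finally have "(of_real ((ip_norm (\<Sum>j\<in>J. g j))\<^sup>2) :: 'k) = of_real (\<Sum>j\<in>J. (ip_norm (g j))\<^sup>2)"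
    by (simp only: of_real_ip_norm_sq of_real_sum)
  then show ?thesis
    by (simp only: of_real_eq_iff)
qed

text \<open>For \<open>u = 0\<close> the coefficient is a division by zero and both sides are \<open>0\<close>.\<close>

lemma orth_proj_span_singleton: "orth_proj (span {u}) x = scale (ip x u / ip u u) u"
proof (rule orth_proj_eqI)
  show "scale (ip x u / ip u u) u \<in> span {u}"
    by (simp add: span_base span_scale)
  have "ip (x - scale (ip x u / ip u u) u) u = 0"
    using ip_self_eq_0[of u] by (cases "u = 0") (auto simp: ip_diff_left ip_scale_left)
  then show "ip (x - scale (ip x u / ip u u) u) w = 0" if "w \<in> span {u}" for w
    using that by (auto simp: span_singleton ip_scale_right)
qed simp

text \<open>Pairing the sum with \<open>f k\<close> leaves only its \<open>k\<close>-th term, and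
  that term has the same inner product with \<open>f k\<close> as \<open>x\<close> itself.\<close>

lemma ip_fourier_residual:
  assumes "finite J" "\<And>j k. j \<in> J \<Longrightarrow> k \<in> J \<Longrightarrow> j \<noteq> k \<Longrightarrow> ip (f j) (f k) = 0" "k \<in> J"
  shows "ip (x - (\<Sum>j\<in>J. orth_proj (span {f j}) x)) (f k) = 0"
proof -
  have "(\<Sum>j\<in>J. ip (orth_proj (span {f j}) x) (f k)) =
      (\<Sum>j\<in>J. if j = k then ip (orth_proj (span {f k}) x) (f k) else 0)"
    by (intro sum.cong refl) (use assms in \<open>auto simp: orth_proj_span_singleton ip_scale_left\<close>)
  also have "\<dots> = ip (orth_proj (span {f k}) x) (f k)"
    using assms by simp
  also have "\<dots> = ip x (f k)"
    \<comment> \<open>If \<open>f k = 0\<close>, both sides vanish; otherwise the denominator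
      \<open>ip (f k) (f k)\<close> is nonzero and cancels.\<close>
    using ip_self_eq_0[of "f k"]
    by (cases "f k = 0") (auto simp: orth_proj_span_singleton ip_scale_left)
  finally show ?thesis
    by (simp add: ip_diff_left ip_sum_left)
qed

lemma frame_for_complete:
  assumes "frame_for W m f" "w \<in> W" "\<And>j. j \<in> {1..m} \<Longrightarrow> ip w (f j) = 0"
  shows "w = 0"
proof -
  obtain A where "0 < A" "A * (ip_norm w)\<^sup>2 \<le> (\<Sum>j=1..m. (norm (ip w (f j)))\<^sup>2)"
    using assms(1,2) by (auto simp: frame_for_def)
  then have "(ip_norm w)\<^sup>2 \<le> 0"
    using assms(3) by (simp add: mult_le_0_iff)
  then show ?thesis
    using ip_self_eq_0 by (simp add: ip_norm_sq)
qed

lemma orth_proj_orthogonal_frame: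
  assumes "subspace W" and fr: "frame_for W m f"
    and orth: "\<And>j k. j \<in> {1..m} \<Longrightarrow> k \<in> {1..m} \<Longrightarrow> j \<noteq> k \<Longrightarrow> ip (f j) (f k) = 0"
  shows "orth_proj W x = (\<Sum>j=1..m. orth_proj (span {f j}) x)"
proof (rule orth_proj_eqI)
  \<comment> \<open>The expansion is needed at two points: at \<open>x\<close>, as the candidate
    projection, and at a test vector \<open>w\<close> of \<open>W\<close>, to write \<open>w\<close>
    in terms of the \<open>f j\<close>.\<close>
  define F where "F z = (\<Sum>j=1..m. orth_proj (span {f j}) z)" for z
  have F_in: "F z \<in> W" for z
    using assms(1) fr unfolding F_def frame_for_def orth_proj_span_singleton
    by (intro subspace_sum subspace_scale) auto
  then show "(\<Sum>j=1..m. orth_proj (span {f j}) x) \<in> W"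
    by (simp add: F_def)
  have residual: "ip (z - F z) (f k) = 0" if "k \<in> {1..m}" for z k
    unfolding F_def using orth that by (intro ip_fourier_residual) auto
  fix w assume "w \<in> W"
  \<comment> \<open>The residual of \<open>w\<close> stays in \<open>W\<close> and is orthogonal to
    every \<open>f k\<close>, so completeness of the frame applies.\<close>
  then have "w - F w = 0"
    using assms(1) F_in residual by (intro frame_for_complete[OF fr]) (auto intro: subspace_diff)
  then have "w = F w"
    by simp
  \<comment> \<open>\<open>F w\<close> is a linear combination of the \<open>f j\<close>, each of
    which is orthogonal to \<open>x - F x\<close>.\<close>
  moreover have "ip (x - F x) (F w) = 0"
    using residual[of _ x] by (simp add: F_def[of w] orth_proj_span_singleton ip_sum_right ip_scale_right)
  ultimately show "ip (x - (\<Sum>j=1..m. orth_proj (span {f j}) x)) w = 0"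
    by (simp add: F_def)
qed (use assms in simp)

text \<open>The projections of \<open>x\<close> onto the lines are multiples of the
  \<open>f j\<close>, hence pairwise orthogonal, so Pythagoras applies to their sum.\<close>

lemma frame_redundancy_orthogonal:
  assumes "subspace W" "frame_for W m f"
    and orth: "\<And>j k. j \<in> {1..m} \<Longrightarrow> k \<in> {1..m} \<Longrightarrow> j \<noteq> k \<Longrightarrow> ip (f j) (f k) = 0"
  shows "(ip_norm (orth_proj W x))\<^sup>2 = frame_redundancy m f x"
proof -
  have "orth_proj W x = (\<Sum>j=1..m. orth_proj (span {f j}) x)"
    using assms by (rule orth_proj_orthogonal_frame)
  moreover have "(ip_norm (\<Sum>j=1..m. orth_proj (span {f j}) x))\<^sup>2 = frame_redundancy m f x"
    unfolding frame_redundancy_def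
    by (rule ip_norm_sum_orthogonal)
       (use orth in \<open>auto simp: orth_proj_span_singleton ip_scale_left ip_scale_right\<close>)
  ultimately show ?thesis
    by simp
qed

end

theorem proposition6p2:
  fixes scale :: "'k::{real_normed_field, conjugatable_field} \<Rightarrow> 'v::ab_group_add \<Rightarrow> 'v"
    and ip :: "'v \<Rightarrow> 'v \<Rightarrow> 'k"
    and n N :: nat
    and W :: "nat \<Rightarrow> 'v set" and v :: "nat \<Rightarrow> real"
    and m :: "nat \<Rightarrow> nat" and f :: "nat \<Rightarrow> nat \<Rightarrow> 'v"
  assumes "hilbert_space_dim scale ip n"
    and "inner_product_space.fusion_frame scale ip N W v"
    and "\<forall>i\<in>{1..N}. inner_product_space.frame_for ip (W i) (m i) (f i)"
    and "\<forall>i\<in>{1..N}. \<forall>j\<in>{1..m i}. \<forall>k\<in>{1..m i}. j \<noteq> k \<longrightarrow> ip (f i j) (f i k) = 0"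
  shows "\<forall>x. inner_product_space.ip_norm ip x = 1 \<longrightarrow>
    inner_product_space.fusion_redundancy ip N W x =
      (\<Sum>i=1..N. inner_product_space.frame_redundancy scale ip (m i) (f i) x)"
proof -
  interpret hilbert_space_dim scale ip n by fact
  \<comment> \<open>The two redundancies agree summand by summand; the fusion frame supplies that
    each \<open>W i\<close> is a subspace.\<close>
  have "(ip_norm (orth_proj (W i) x))\<^sup>2 = frame_redundancy (m i) (f i) x" if "i \<in> {1..N}" for i x
    using assms(2-4) that by (intro frame_redundancy_orthogonal) (auto simp: fusion_frame_def)
  then show ?thesis
    by (simp add: fusion_redundancy_def)
qed

end
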